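(* Let $\mathcal{R}$ be a Borel equivalence relation with countable classes on a standard Borel space $X$, let $\mathcal{A}$ be an $\mathcal{R}$-arboretum on $X$, and let a desingularization of the action of $\mathcal{R}$ on $\mathcal{A}$ be given, with graph of relations $G^r$ (underlying oriented graph $G$), rooted maximal subtree $A_m$, representation $\chi$ and partial isomorphisms $\phi_a$. Let $\mathcal{R}'$ be the sub-relation of $\mathcal{R}$ on $X$ generated by all the relations carried by the vertices of $G$, identified via $\chi$ with sub-relations of $\mathcal{R}$ on Borel subsets of $X$, and let $\mathcal{R}''$ be the sub-relation of $\mathcal{R}$ generated by the partial isomorphisms $\phi_a$ carried by the edges $a$ of $G$. Then $\mathcal{R}$ is generated by $\mathcal{R}'$ and $\mathcal{R}''$.
   Context: Fibred spaces and actions. A fibred standard space over $X$ is a standard Borel space $F$ with a surjective Borel map $\pi:F\to X$ with countable preimages; $F_x=\pi^{-1}(x)$. An $\mathcal{R}$-action on $F$ (then $F$ is an $\mathcal{R}$-fibred standard space) is a Borel map assigning to $(x,y)\in\mathcal{R}$ and $f\in F_y$ an element $(x,y)\cdot f\in F_x$, with $(y,y)\cdot f=f$ and $(x,y)\cdot((y,z)\cdot f)=(x,z)\cdot f$. $\mathcal{R}_F$ is the orbit equivalence relation on $F$: $f_x\in F_x$, $f_y\in F_y$ are equivalent iff $(x,y)\in\mathcal{R}$ and $(x,y)\cdot f_y=f_x$. Morphisms are equivariant fibre-preserving Borel maps. A partial section is a Borel map $s:B\to F$, $B\subset X$ Borel, with $\pi\circ s=\mathrm{id}_B$; $\mathrm{Stab}_{\mathcal{R}}(s)$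 is the sub-relation of $\mathcal{R}$ on $B$: $x\sim y$ iff $(x,y)\in\mathcal R$ and $(y,x)\cdot s(x)=s(y)$. $[[\mathcal{R}]]$ is the set of Borel isomorphisms between Borel subsets of $X$ with graph contained in $\mathcal{R}$. A fundamental domain of a Borel equivalence relation is a Borel set meeting each class in exactly one point. Arboretums. Graphs are in the sense of Serre (edges $a$ with origin $o(a)$, terminal vertex $t(a)$, opposite edge $\bar a\ne a$). A Borel $\mathcal{R}$-field of graphs $\mathcal{A}$ on $X$ is a graph whose vertex space $\mathcal{A}^0$ and edge space $\mathcal{A}^1$ are $\mathcal{R}$-fibred standard spaces and for which $o,t,\bar{\ }$ are morphisms; it is an $\mathcal{R}$-arboretum if each fibre $\mathcal{A}_x$ is a tree. An arboretum (without $\mathcal{R}$) is the same notion for the trivial relation; a sub-arboretum of the restriction $\mathcal{A}|_Y$ to a Borel $Y\subset X$ is a Borel subgraph, all of whose fibres over $Y$ are trees (no invariance required). Graphs of relations. A graph of relations $G^r$ consists of a countable graph $G$, a Borel equivalence relation $\mathcal{R}_P$ on a standard Borel space $X_P$ for each vertex $P$, a Borel equivalence relation $\mathcal{R}_a$ on a standard Borel space $X_a$ for each edge $a$ with $\mathcal{R}_a=\mathcal{R}_{\bar a}$ (and $X_a=X_{\bar a}$), and for each edge $a$ an injective morphism from $\mathcal{R}_a$ to $\mathcal{R}_{t(a)}$, i.e. an injective Borel map $j_a:X_a\to X_{t(a)}$ sending equivalent points to equivalent points. Each edge $a$ thus carries the partial isomorphism $j_a\circ j_{\bar a}^{-1}$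 from a Borel subset of $X_{o(a)}$ to a Borel subset of $X_{t(a)}$. If $G$ is a tree (tree of relations), these partial isomorphisms generate a Borel equivalence relation on $\bigsqcup_P X_P$; $G^r$ is rooted at a vertex $P_0$ (the root) if $X_{P_0}$ is a fundamental domain of this relation. A rooted tree of relations defines an arboretum on $X_{P_0}$, with vertex space $\bigsqcup_PX_P$, edge space $\bigsqcup_aX_a$, the endpoints of a point $u\in X_a$ being $j_{\bar a}(u)\in X_{o(a)}$ and $j_a(u)\in X_{t(a)}$, and projection sending a vertex to the unique equivalent point of $X_{P_0}$. Representation. A representation of a rooted tree of relations $G^r$ in $\mathcal{A}$ is a Borel isomorphism of $X_{P_0}$ onto a Borel subset $Y\subset X$ and, over it, an isomorphism $\chi$ from the arboretum defined by $G^r$ onto a sub-arboretum of $\mathcal{A}|_Y$, such that $\chi$ induces isomorphisms of $\mathcal{R}_P$ onto $\mathcal{R}_{\mathcal{A}^0}|_{\chi(X_P)}$ for each vertex $P$ and of $\mathcal{R}_a$ onto $\mathcal{R}_{\mathcal{A}^1}|_{\chi(X_a)}$ for each edge $a$. The sets $\chi(X_P),\chi(X_a)$ are called the representations of $X_P,X_a$. An arboretum of representatives of the action is a rooted tree of relations with a representation $\chi$ in $\mathcal{A}$ such that the $\mathcal{R}_{\mathcal{A}^0}$-saturations of the $\chi(X_P)$ form a partition of $\mathcal{A}^0$. Via $\pi\circ\chi$, $X_P$ is identified with a Borel subset of $X$ and $\mathcal{R}_P$ with a sub-relation of $\mathcal{R}$ on it. Desingularization. A desingularization of the action of $\mathcal{R}$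 on $\mathcal{A}$ consists of a graph of relations $G^r$ whose underlying graph $G$ is oriented, a rooted maximal subtree $A_m$ of $G$, and for each edge $a$ of the orientation not in $A_m$ an element $\phi_a\in[[\mathcal{R}]]$, such that: (1) the rooted tree of relations induced by $G^r$ on $A_m$, with a representation $\chi$, is an arboretum of representatives for which the space carried by the root is identified with $X$ (i.e. $Y=X$); (2) for each edge $a$ of the orientation not in $A_m$ there is a partial section of edges $s_a$ defined on the source of $\phi_a$ such that $o(s_a(x))\in\chi(X_{o(a)})$ and $(\phi_a(x),x)\cdot t(s_a(x))\in\chi(X_{t(a)})$ for all $x$; the image of $s_a$ is called a representation of $X_a$ (and the set of opposite edges a representation of $X_{\bar a}$); (3) for each such $a$, $\chi$ induces an isomorphism between $\mathrm{Stab}_{\mathcal{R}}(s_a)$, viewed as a sub-relation of the representation of $\mathcal{R}_{o(a)}$, and the image of $\mathcal{R}_{\bar a}$ in $\mathcal{R}_{t(\bar a)}=\mathcal{R}_{o(a)}$ by the injective morphism associated with $\bar a$; and an isomorphism between $\phi_a\mathrm{Stab}_{\mathcal{R}}(s_a)\phi_a^{-1}$ (the relation transported by $\phi_a$ to its range), viewed as a sub-relation of the representation of $\mathcal{R}_{t(a)}$, and the image of $\mathcal{R}_a$ in $\mathcal{R}_{t(a)}$ by the injective morphism associated with $a$; (4) the $\mathcal{R}_{\mathcal{A}^1}$-saturations of the representations of the spaces carried by the edges of $G^r$ form a partition of $\mathcal{A}^1$. Conventions: $\phi_{\bar a}=\phi_a^{-1}$ for $a$ in the orientation and not in $A_m$;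 for an edge $a$ of $A_m$, $\phi_a$ is the restriction of the identity of $X$ to the projection in $X$ of the representation of $X_{o(a)}$. "Generated by" means the smallest equivalence relation on $X$ containing the given relations (or graphs of partial isomorphisms). *)

theory Defs
  imports "HOL-Analysis.Analysis" "Graph_Theory.Graph_Theory"
begin

section \<open>Standard Borel spaces and Borel equivalence relations\<close>

text \<open>
  Measurable spaces are represented by the type of measures, only \<open>space\<close> and \<open>sets\<close> being relevant.
\<close>

definition standard_borel :: "'x measure \<Rightarrow> bool" where
  "standard_borel M \<longleftrightarrow>
     (\<exists>T. completely_metrizable_space T \<and> second_countable T \<and>
          space M = topspace T \<and> sets M = sigma_sets (topspace T) {U. openin T U})"

definition borel_iso :: "'x measure \<Rightarrow> 'y measure \<Rightarrow> ('x \<Rightarrow> 'y) \<Rightarrow> bool" where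
  "borel_iso M N f \<longleftrightarrow>
     bij_betw f (space M) (space N) \<and> f \<in> M \<rightarrow>\<^sub>M N \<and> inv_into (space M) f \<in> N \<rightarrow>\<^sub>M M"

definition borel_equiv_rel :: "'x measure \<Rightarrow> ('x \<times> 'x) set \<Rightarrow> bool" where
  "borel_equiv_rel M R \<longleftrightarrow> equiv (space M) R \<and> R \<in> sets (M \<Otimes>\<^sub>M M)"

definition countable_classes :: "'x measure \<Rightarrow> ('x \<times> 'x) set \<Rightarrow> bool" where
  "countable_classes M R \<longleftrightarrow> (\<forall>x\<in>space M. countable (R `` {x}))"

definition rel_iso ::
  "'x measure \<Rightarrow> ('x \<times> 'x) set \<Rightarrow> 'y measure \<Rightarrow> ('y \<times> 'y) set \<Rightarrow> ('x \<Rightarrow> 'y) \<Rightarrow> bool" where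
  "rel_iso M R N S f \<longleftrightarrow>
     borel_iso M N f \<and>
     (\<forall>x\<in>space M. \<forall>y\<in>space M. (x, y) \<in> R \<longleftrightarrow> (f x, f y) \<in> S)"

definition gen_equiv :: "'x set \<Rightarrow> ('x \<times> 'x) set \<Rightarrow> ('x \<times> 'x) set" where
  "gen_equiv C S = \<Inter>{E. equiv C E \<and> S \<subseteq> E}"

definition fundamental_domain :: "'x measure \<Rightarrow> ('x \<times> 'x) set \<Rightarrow> 'x set \<Rightarrow> bool" where
  "fundamental_domain M R D \<longleftrightarrow>
     D \<in> sets M \<and> (\<forall>C \<in> space M // R. is_singleton (C \<inter> D))"

text \<open>The full pseudogroup \<open>[[R]]\<close>; a partial map \<open>f\<close> has source \<open>dom f\<close> and range \<open>ran f\<close>.\<close>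

definition full_pseudogroup :: "'x measure \<Rightarrow> ('x \<times> 'x) set \<Rightarrow> ('x \<rightharpoonup> 'x) set" where
  "full_pseudogroup M R =
     {f. dom f \<in> sets M \<and> ran f \<in> sets M \<and>
         borel_iso (restrict_space M (dom f)) (restrict_space M (ran f)) (\<lambda>x. the (f x)) \<and>
         Map.graph f \<subseteq> R}"

definition disjoint_sum :: "'i set \<Rightarrow> ('i \<Rightarrow> 'x measure) \<Rightarrow> ('i \<times> 'x) measure" where
  "disjoint_sum I M =
     sigma (SIGMA i:I. space (M i))
       {S. S \<subseteq> (SIGMA i:I. space (M i)) \<and> (\<forall>i\<in>I. {u. (i, u) \<in> S} \<in> sets (M i))}"


section \<open>Fibred spaces and actions\<close>

record ('x, 'f) fibred_space =
  carr :: "'f measure"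
  proj :: "'f \<Rightarrow> 'x"
  act :: "'x \<Rightarrow> 'x \<Rightarrow> 'f \<Rightarrow> 'f"  \<comment> \<open>\<open>act x y f\<close> stands for \<open>(x, y) \<cdot> f\<close>\<close>

definition fibre :: "('x, 'f) fibred_space \<Rightarrow> 'x \<Rightarrow> 'f set" where
  "fibre F x = {f \<in> space (carr F). proj F f = x}"

definition fibred_standard_space :: "'x measure \<Rightarrow> ('x, 'f) fibred_space \<Rightarrow> bool" where
  "fibred_standard_space X F \<longleftrightarrow>
     standard_borel (carr F) \<and> proj F \<in> carr F \<rightarrow>\<^sub>M X \<and>
     proj F ` space (carr F) = space X \<and>
     (\<forall>x\<in>space X. countable (fibre F x))"

definition rel_fibred_standard_space ::
  "'x measure \<Rightarrow> ('x \<times> 'x) set \<Rightarrow> ('x, 'f) fibred_space \<Rightarrow> bool" where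
  "rel_fibred_standard_space X R F \<longleftrightarrow>
     fibred_standard_space X F \<and>
     (\<lambda>((x, y), f). act F x y f)
       \<in> restrict_space ((X \<Otimes>\<^sub>M X) \<Otimes>\<^sub>M carr F) {((x, y), f). (x, y) \<in> R \<and> f \<in> fibre F y}
         \<rightarrow>\<^sub>M carr F \<and>
     (\<forall>x y. (x, y) \<in> R \<longrightarrow> (\<forall>f\<in>fibre F y. act F x y f \<in> fibre F x)) \<and>
     (\<forall>y\<in>space X. \<forall>f\<in>fibre F y. act F y y f = f) \<and>
     (\<forall>x y z. (x, y) \<in> R \<longrightarrow> (y, z) \<in> R \<longrightarrow>
        (\<forall>f\<in>fibre F z. act F x y (act F y z f) = act F x z f))"

definition morphism ::
  "('x \<times> 'x) set \<Rightarrow> ('x, 'f) fibred_space \<Rightarrow> ('x, 'g) fibred_space \<Rightarrow> ('f \<Rightarrow> 'g) \<Rightarrow> bool" where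
  "morphism R F G h \<longleftrightarrow>
     h \<in> carr F \<rightarrow>\<^sub>M carr G \<and>
     (\<forall>f\<in>space (carr F). proj G (h f) = proj F f) \<and>
     (\<forall>x y. (x, y) \<in> R \<longrightarrow> (\<forall>f\<in>fibre F y. h (act F x y f) = act G x y (h f)))"

definition orbit_rel :: "('x \<times> 'x) set \<Rightarrow> ('x, 'f) fibred_space \<Rightarrow> ('f \<times> 'f) set" where
  "orbit_rel R F =
     {(f, g). f \<in> space (carr F) \<and> g \<in> space (carr F) \<and>
              (proj F f, proj F g) \<in> R \<and> act F (proj F f) (proj F g) g = f}"

definition partial_section ::
  "'x measure \<Rightarrow> ('x, 'f) fibred_space \<Rightarrow> 'x set \<Rightarrow> ('x \<Rightarrow> 'f) \<Rightarrow> bool" where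
  "partial_section X F B s \<longleftrightarrow>
     B \<in> sets X \<and> s \<in> restrict_space X B \<rightarrow>\<^sub>M carr F \<and> (\<forall>x\<in>B. proj F (s x) = x)"

definition stab ::
  "('x \<times> 'x) set \<Rightarrow> ('x, 'f) fibred_space \<Rightarrow> 'x set \<Rightarrow> ('x \<Rightarrow> 'f) \<Rightarrow> ('x \<times> 'x) set" where
  "stab R F B s = {(x, y). x \<in> B \<and> y \<in> B \<and> (x, y) \<in> R \<and> act F y x (s x) = s y}"


section \<open>Graphs and trees in the sense of Serre\<close>

text \<open>
  In \<^locale>\<open>bidirected_digraph\<close> the inversion is required to be the identity outside the set of arcs;
  here \<open>bar\<close> is arbitrary there.
\<close>

definition serre_graph :: "('v, 'e) pre_digraph \<Rightarrow> ('e \<Rightarrow> 'e) \<Rightarrow> bool" where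
  "serre_graph G bar \<longleftrightarrow> bidirected_digraph G (\<lambda>e. if e \<in> arcs G then bar e else e)"

text \<open>
  A circuit is a nonempty closed path without backtracking passing through distinct vertices
  (loops and pairs of parallel edges included).
\<close>

definition circuit :: "('v, 'e) pre_digraph \<Rightarrow> ('e \<Rightarrow> 'e) \<Rightarrow> 'e list \<Rightarrow> bool" where
  "circuit G bar p \<longleftrightarrow> pre_digraph.cycle G p \<and> successively (\<lambda>a b. b \<noteq> bar a) p"

definition serre_tree :: "('v, 'e) pre_digraph \<Rightarrow> ('e \<Rightarrow> 'e) \<Rightarrow> bool" where
  "serre_tree G bar \<longleftrightarrow>
     serre_graph G bar \<and> strongly_connected G \<and> (\<nexists>p. circuit G bar p)"

definition maximal_subtree ::
  "('v, 'e) pre_digraph \<Rightarrow> ('e \<Rightarrow> 'e) \<Rightarrow> ('v, 'e) pre_digraph \<Rightarrow> bool" where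
  "maximal_subtree G bar T \<longleftrightarrow>
     subgraph T G \<and> serre_tree T bar \<and>
     (\<forall>T'. subgraph T' G \<and> serre_tree T' bar \<and> subgraph T T' \<longrightarrow> T' = T)"

definition orientation :: "('v, 'e) pre_digraph \<Rightarrow> ('e \<Rightarrow> 'e) \<Rightarrow> 'e set \<Rightarrow> bool" where
  "orientation G bar Or \<longleftrightarrow> Or \<subseteq> arcs G \<and> (\<forall>a\<in>arcs G. a \<in> Or \<longleftrightarrow> bar a \<notin> Or)"


section \<open>Borel fields of graphs and arboretums\<close>

record ('x, 'v, 'e) graph_field =
  vtx :: "('x, 'v) fibred_space"
  edg :: "('x, 'e) fibred_space"
  org :: "'e \<Rightarrow> 'v"
  ter :: "'e \<Rightarrow> 'v"
  opp :: "'e \<Rightarrow> 'e"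

definition subfield_fibre ::
  "('x, 'v, 'e) graph_field \<Rightarrow> 'v set \<Rightarrow> 'e set \<Rightarrow> 'x \<Rightarrow> ('v, 'e) pre_digraph" where
  "subfield_fibre A V E x =
     \<lparr>verts = V \<inter> fibre (vtx A) x, arcs = E \<inter> fibre (edg A) x, tail = org A, head = ter A\<rparr>"

definition field_fibre :: "('x, 'v, 'e) graph_field \<Rightarrow> 'x \<Rightarrow> ('v, 'e) pre_digraph" where
  "field_fibre A = subfield_fibre A (space (carr (vtx A))) (space (carr (edg A)))"

definition borel_graph_field ::
  "'x measure \<Rightarrow> ('x \<times> 'x) set \<Rightarrow> ('x, 'v, 'e) graph_field \<Rightarrow> bool" where
  "borel_graph_field X R A \<longleftrightarrow>
     rel_fibred_standard_space X R (vtx A) \<and> rel_fibred_standard_space X R (edg A) \<and>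
     morphism R (edg A) (vtx A) (org A) \<and> morphism R (edg A) (vtx A) (ter A) \<and>
     morphism R (edg A) (edg A) (opp A) \<and>
     (\<forall>x\<in>space X. serre_graph (field_fibre A x) (opp A))"

definition arboretum ::
  "'x measure \<Rightarrow> ('x \<times> 'x) set \<Rightarrow> ('x, 'v, 'e) graph_field \<Rightarrow> bool" where
  "arboretum X R A \<longleftrightarrow>
     borel_graph_field X R A \<and> (\<forall>x\<in>space X. serre_tree (field_fibre A x) (opp A))"

text \<open>
  \<open>(V, E)\<close> is a sub-arboretum of \<open>A\<close> restricted to \<open>Y\<close>.  That \<open>E\<close> is closed under \<open>opp A\<close> and has its
  endpoints in \<open>V\<close> is part of the fibres being trees.
\<close>

definition sub_arboretum ::
  "'x measure \<Rightarrow> ('x, 'v, 'e) graph_field \<Rightarrow> 'x set \<Rightarrow> 'v set \<Rightarrow> 'e set \<Rightarrow> bool" where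
  "sub_arboretum X A Y V E \<longleftrightarrow>
     Y \<in> sets X \<and> V \<in> sets (carr (vtx A)) \<and> E \<in> sets (carr (edg A)) \<and>
     proj (vtx A) ` V \<subseteq> Y \<and> proj (edg A) ` E \<subseteq> Y \<and>
     (\<forall>y\<in>Y. serre_tree (subfield_fibre A V E y) (opp A))"


section \<open>Graphs of relations\<close>

text \<open>\<open>inj_map a\<close> is the injective morphism from the relation of \<open>a\<close> to that of \<open>head a\<close>.\<close>

record ('p, 'a, 'b, 'c) rel_graph =
  graph_of :: "('p, 'a) pre_digraph"
  bar_of :: "'a \<Rightarrow> 'a"
  vspace :: "'p \<Rightarrow> 'b measure"
  vrel :: "'p \<Rightarrow> ('b \<times> 'b) set"
  espace :: "'a \<Rightarrow> 'c measure"
  erel :: "'a \<Rightarrow> ('c \<times> 'c) set"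
  inj_map :: "'a \<Rightarrow> 'c \<Rightarrow> 'b"

definition graph_of_relations :: "('p, 'a, 'b, 'c) rel_graph \<Rightarrow> bool" where
  "graph_of_relations D \<longleftrightarrow>
     serre_graph (graph_of D) (bar_of D) \<and>
     countable (verts (graph_of D)) \<and> countable (arcs (graph_of D)) \<and>
     (\<forall>P\<in>verts (graph_of D). standard_borel (vspace D P) \<and> borel_equiv_rel (vspace D P) (vrel D P)) \<and>
     (\<forall>a\<in>arcs (graph_of D).
        standard_borel (espace D a) \<and> borel_equiv_rel (espace D a) (erel D a) \<and>
        sets (espace D (bar_of D a)) = sets (espace D a) \<and> erel D (bar_of D a) = erel D a \<and>
        inj_map D a \<in> espace D a \<rightarrow>\<^sub>M vspace D (head (graph_of D) a) \<and>
        inj_on (inj_map D a) (space (espace D a)) \<and>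
        (\<forall>(u, v)\<in>erel D a. (inj_map D a u, inj_map D a v) \<in> vrel D (head (graph_of D) a)))"

definition induced_rel_graph ::
  "('p, 'a, 'b, 'c) rel_graph \<Rightarrow> ('p, 'a) pre_digraph \<Rightarrow> ('p, 'a, 'b, 'c) rel_graph" where
  "induced_rel_graph D T = D\<lparr>graph_of := T\<rparr>"

definition edge_origin :: "('p, 'a, 'b, 'c) rel_graph \<Rightarrow> 'a \<times> 'c \<Rightarrow> 'p \<times> 'b" where
  "edge_origin D = (\<lambda>(a, u). (tail (graph_of D) a, inj_map D (bar_of D a) u))"

definition edge_terminus :: "('p, 'a, 'b, 'c) rel_graph \<Rightarrow> 'a \<times> 'c \<Rightarrow> 'p \<times> 'b" where
  "edge_terminus D = (\<lambda>(a, u). (head (graph_of D) a, inj_map D a u))"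

definition total_vspace :: "('p, 'a, 'b, 'c) rel_graph \<Rightarrow> ('p \<times> 'b) measure" where
  "total_vspace D = disjoint_sum (verts (graph_of D)) (vspace D)"

definition total_espace :: "('p, 'a, 'b, 'c) rel_graph \<Rightarrow> ('a \<times> 'c) measure" where
  "total_espace D = disjoint_sum (arcs (graph_of D)) (espace D)"

text \<open>
  The equivalence relation on the disjoint union of the \<open>X_P\<close> generated by the partial isomorphisms
  carried by the edges.
\<close>

definition tree_rel :: "('p, 'a, 'b, 'c) rel_graph \<Rightarrow> (('p \<times> 'b) \<times> ('p \<times> 'b)) set" where
  "tree_rel D =
     gen_equiv (space (total_vspace D))
       ((\<lambda>e. (edge_origin D e, edge_terminus D e)) ` space (total_espace D))"

definition rooted_tree_of_relations :: "('p, 'a, 'b, 'c) rel_graph \<Rightarrow> 'p \<Rightarrow> bool" where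
  "rooted_tree_of_relations D P0 \<longleftrightarrow>
     graph_of_relations D \<and> serre_tree (graph_of D) (bar_of D) \<and> P0 \<in> verts (graph_of D) \<and>
     fundamental_domain (total_vspace D) (tree_rel D) ({P0} \<times> space (vspace D P0))"

definition root_proj :: "('p, 'a, 'b, 'c) rel_graph \<Rightarrow> 'p \<Rightarrow> 'p \<times> 'b \<Rightarrow> 'b" where
  "root_proj D P0 v = (THE w. w \<in> space (vspace D P0) \<and> (v, (P0, w)) \<in> tree_rel D)"

text \<open>
  The arboretum on \<open>X_P0\<close> defined by a rooted tree of relations; it carries the action of the trivial
  relation.
\<close>

definition tree_arboretum ::
  "('p, 'a, 'b, 'c) rel_graph \<Rightarrow> 'p \<Rightarrow> ('b, 'p \<times> 'b, 'a \<times> 'c) graph_field" where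
  "tree_arboretum D P0 =
     \<lparr>vtx = \<lparr>carr = total_vspace D, proj = root_proj D P0, act = (\<lambda>_ _ v. v)\<rparr>,
      edg = \<lparr>carr = total_espace D, proj = root_proj D P0 \<circ> edge_origin D, act = (\<lambda>_ _ e. e)\<rparr>,
      org = edge_origin D, ter = edge_terminus D, opp = (\<lambda>(a, u). (bar_of D a, u))\<rparr>"


section \<open>Representations and desingularizations\<close>

record ('x, 'v, 'e, 'p, 'a, 'b, 'c) rep_map =
  base_map :: "'b \<Rightarrow> 'x"
  vmap :: "'p \<times> 'b \<Rightarrow> 'v"
  emap :: "'a \<times> 'c \<Rightarrow> 'e"

definition vrep ::
  "('p, 'a, 'b, 'c) rel_graph \<Rightarrow> ('x, 'v, 'e, 'p, 'a, 'b, 'c) rep_map \<Rightarrow> 'p \<Rightarrow> 'v set" where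
  "vrep D \<rho> P = (\<lambda>u. vmap \<rho> (P, u)) ` space (vspace D P)"

definition erep ::
  "('p, 'a, 'b, 'c) rel_graph \<Rightarrow> ('x, 'v, 'e, 'p, 'a, 'b, 'c) rep_map \<Rightarrow> 'a \<Rightarrow> 'e set" where
  "erep D \<rho> a = (\<lambda>u. emap \<rho> (a, u)) ` space (espace D a)"

definition graph_field_iso_onto ::
  "'y measure \<Rightarrow> ('y, 'w, 'd) graph_field \<Rightarrow> 'x measure \<Rightarrow> ('x, 'v, 'e) graph_field \<Rightarrow>
   'x set \<Rightarrow> 'v set \<Rightarrow> 'e set \<Rightarrow> ('y \<Rightarrow> 'x) \<Rightarrow> ('w \<Rightarrow> 'v) \<Rightarrow> ('d \<Rightarrow> 'e) \<Rightarrow> bool" where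
  "graph_field_iso_onto Z B X A Y V E \<theta> f g \<longleftrightarrow>
     borel_iso Z (restrict_space X Y) \<theta> \<and>
     borel_iso (carr (vtx B)) (restrict_space (carr (vtx A)) V) f \<and>
     borel_iso (carr (edg B)) (restrict_space (carr (edg A)) E) g \<and>
     (\<forall>v\<in>space (carr (vtx B)). proj (vtx A) (f v) = \<theta> (proj (vtx B) v)) \<and>
     (\<forall>e\<in>space (carr (edg B)).
        proj (edg A) (g e) = \<theta> (proj (edg B) e) \<and>
        org A (g e) = f (org B e) \<and> ter A (g e) = f (ter B e) \<and> opp A (g e) = g (opp B e))"

definition representation ::
  "'x measure \<Rightarrow> ('x \<times> 'x) set \<Rightarrow> ('x, 'v, 'e) graph_field \<Rightarrow> ('p, 'a, 'b, 'c) rel_graph \<Rightarrow> 'p \<Rightarrow>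
   'x set \<Rightarrow> ('x, 'v, 'e, 'p, 'a, 'b, 'c) rep_map \<Rightarrow> bool" where
  "representation X R A D P0 Y \<rho> \<longleftrightarrow>
     (\<exists>V E. sub_arboretum X A Y V E \<and>
        graph_field_iso_onto (vspace D P0) (tree_arboretum D P0) X A Y V E
          (base_map \<rho>) (vmap \<rho>) (emap \<rho>)) \<and>
     (\<forall>P\<in>verts (graph_of D).
        rel_iso (vspace D P) (vrel D P)
          (restrict_space (carr (vtx A)) (vrep D \<rho> P))
          (orbit_rel R (vtx A) \<inter> vrep D \<rho> P \<times> vrep D \<rho> P)
          (\<lambda>u. vmap \<rho> (P, u))) \<and>
     (\<forall>a\<in>arcs (graph_of D).
        rel_iso (espace D a) (erel D a)
          (restrict_space (carr (edg A)) (erep D \<rho> a))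
          (orbit_rel R (edg A) \<inter> erep D \<rho> a \<times> erep D \<rho> a)
          (\<lambda>u. emap \<rho> (a, u)))"

text \<open>
  A family of sets whose saturations form a partition.  Members may be empty, since the spaces
  carried by a graph of relations may be.
\<close>

definition saturations_partition ::
  "'f measure \<Rightarrow> ('f \<times> 'f) set \<Rightarrow> 'i set \<Rightarrow> ('i \<Rightarrow> 'f set) \<Rightarrow> bool" where
  "saturations_partition M S I B \<longleftrightarrow>
     disjoint_family_on (\<lambda>i. S `` B i) I \<and> (\<Union>i\<in>I. S `` B i) = space M"

definition arboretum_of_representatives ::
  "'x measure \<Rightarrow> ('x \<times> 'x) set \<Rightarrow> ('x, 'v, 'e) graph_field \<Rightarrow> ('p, 'a, 'b, 'c) rel_graph \<Rightarrow> 'p \<Rightarrow>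
   'x set \<Rightarrow> ('x, 'v, 'e, 'p, 'a, 'b, 'c) rep_map \<Rightarrow> bool" where
  "arboretum_of_representatives X R A D P0 Y \<rho> \<longleftrightarrow>
     rooted_tree_of_relations D P0 \<and> representation X R A D P0 Y \<rho> \<and>
     saturations_partition (carr (vtx A)) (orbit_rel R (vtx A)) (verts (graph_of D)) (vrep D \<rho>)"

text \<open>The identification of \<open>X_P\<close> with a subset of \<open>X\<close>.\<close>

definition ident ::
  "('x, 'v, 'e) graph_field \<Rightarrow> ('x, 'v, 'e, 'p, 'a, 'b, 'c) rep_map \<Rightarrow> 'p \<Rightarrow> 'b \<Rightarrow> 'x" where
  "ident A \<rho> P u = proj (vtx A) (vmap \<rho> (P, u))"

definition inj_image_space ::
  "('p, 'a, 'b, 'c) rel_graph \<Rightarrow> 'a \<Rightarrow> 'b measure" where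
  "inj_image_space D a =
     restrict_space (vspace D (head (graph_of D) a)) (inj_map D a ` space (espace D a))"

definition inj_image_rel ::
  "('p, 'a, 'b, 'c) rel_graph \<Rightarrow> 'a \<Rightarrow> ('b \<times> 'b) set" where
  "inj_image_rel D a = map_prod (inj_map D a) (inj_map D a) ` erel D a"

text \<open>
  Conditions on the section \<open>s\<close> of edges and the partial isomorphism \<open>\<phi>\<close> attached to an oriented edge
  \<open>a\<close> outside the maximal subtree.  A point \<open>x\<close> of the source of \<open>\<phi>\<close> corresponds to the vertex
  \<open>o(s(x))\<close> in the representation of \<open>X_o(a)\<close>, and \<open>\<phi>(x)\<close> to the vertex \<open>(\<phi>(x),x) \<cdot> t(s(x))\<close> in that
  of \<open>X_t(a)\<close>; these are the points matched by \<open>ident\<close>.  Recall \<open>head (bar a) = tail a\<close>.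
\<close>

definition edge_representation ::
  "'x measure \<Rightarrow> ('x \<times> 'x) set \<Rightarrow> ('x, 'v, 'e) graph_field \<Rightarrow> ('p, 'a, 'b, 'c) rel_graph \<Rightarrow>
   ('x, 'v, 'e, 'p, 'a, 'b, 'c) rep_map \<Rightarrow> 'a \<Rightarrow> ('x \<rightharpoonup> 'x) \<Rightarrow> ('x \<Rightarrow> 'e) \<Rightarrow> bool" where
  "edge_representation X R A D \<rho> a \<phi> s \<longleftrightarrow>
     \<phi> \<in> full_pseudogroup X R \<and>
     partial_section X (edg A) (dom \<phi>) s \<and>
     (\<forall>x\<in>dom \<phi>. org A (s x) \<in> vrep D \<rho> (tail (graph_of D) a) \<and>
        act (vtx A) (the (\<phi> x)) x (ter A (s x)) \<in> vrep D \<rho> (head (graph_of D) a)) \<and>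
     rel_iso (inj_image_space D (bar_of D a)) (inj_image_rel D (bar_of D a))
       (restrict_space X (dom \<phi>)) (stab R (edg A) (dom \<phi>) s)
       (ident A \<rho> (tail (graph_of D) a)) \<and>
     rel_iso (inj_image_space D a) (inj_image_rel D a)
       (restrict_space X (ran \<phi>))
       (map_prod (\<lambda>x. the (\<phi> x)) (\<lambda>x. the (\<phi> x)) ` stab R (edg A) (dom \<phi>) s)
       (ident A \<rho> (head (graph_of D) a))"

definition full_erep ::
  "('x, 'v, 'e) graph_field \<Rightarrow> ('p, 'a, 'b, 'c) rel_graph \<Rightarrow> 'a set \<Rightarrow> ('p, 'a) pre_digraph \<Rightarrow>
   ('x, 'v, 'e, 'p, 'a, 'b, 'c) rep_map \<Rightarrow> ('a \<Rightarrow> 'x \<rightharpoonup> 'x) \<Rightarrow> ('a \<Rightarrow> 'x \<Rightarrow> 'e) \<Rightarrow> 'a \<Rightarrow> 'e set" where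
  "full_erep A D Or T \<rho> \<phi> s a =
     (if a \<in> arcs T then erep D \<rho> a
      else if a \<in> Or then s a ` dom (\<phi> a)
      else opp A ` s (bar_of D a) ` dom (\<phi> (bar_of D a)))"

text \<open>
  A desingularization: graph of relations \<open>D\<close> on a connected graph with orientation \<open>Or\<close>, maximal
  subtree \<open>T\<close> with root \<open>P0\<close>, representation \<open>\<rho>\<close>, and partial isomorphisms \<open>\<phi> a\<close>, of which only those
  for \<open>a \<in> Or - arcs T\<close> are relevant.  Connectedness makes \<open>T\<close> contain every vertex, so that \<open>\<rho>\<close>
  is meaningful on all \<open>X_P\<close>.
\<close>

definition desingularization ::
  "'x measure \<Rightarrow> ('x \<times> 'x) set \<Rightarrow> ('x, 'v, 'e) graph_field \<Rightarrow> ('p, 'a, 'b, 'c) rel_graph \<Rightarrow>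
   'a set \<Rightarrow> ('p, 'a) pre_digraph \<Rightarrow> 'p \<Rightarrow> ('x, 'v, 'e, 'p, 'a, 'b, 'c) rep_map \<Rightarrow>
   ('a \<Rightarrow> 'x \<rightharpoonup> 'x) \<Rightarrow> bool" where
  "desingularization X R A D Or T P0 \<rho> \<phi> \<longleftrightarrow>
     graph_of_relations D \<and> strongly_connected (graph_of D) \<and>
     orientation (graph_of D) (bar_of D) Or \<and>
     maximal_subtree (graph_of D) (bar_of D) T \<and>
     arboretum_of_representatives X R A (induced_rel_graph D T) P0 (space X) \<rho> \<and>
     (\<exists>s. (\<forall>a \<in> Or - arcs T. edge_representation X R A D \<rho> a (\<phi> a) (s a)) \<and>
          saturations_partition (carr (edg A)) (orbit_rel R (edg A)) (arcs (graph_of D))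
            (full_erep A D Or T \<rho> \<phi> s))"


section \<open>The relations carried by the vertices and the edges\<close>

text \<open>Graph of the partial isomorphism \<open>\<phi>_a\<close> for an arbitrary edge \<open>a\<close>.\<close>

definition full_phi ::
  "('x, 'v, 'e) graph_field \<Rightarrow> ('p, 'a, 'b, 'c) rel_graph \<Rightarrow> 'a set \<Rightarrow> ('p, 'a) pre_digraph \<Rightarrow>
   ('x, 'v, 'e, 'p, 'a, 'b, 'c) rep_map \<Rightarrow> ('a \<Rightarrow> 'x \<rightharpoonup> 'x) \<Rightarrow> 'a \<Rightarrow> ('x \<times> 'x) set" where
  "full_phi A D Or T \<rho> \<phi> a =
     (if a \<in> arcs T then Id_on (proj (vtx A) ` vrep D \<rho> (tail (graph_of D) a))
      else if a \<in> Or then Map.graph (\<phi> a)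
      else (Map.graph (\<phi> (bar_of D a)))\<inverse>)"

definition vertex_generated ::
  "'x measure \<Rightarrow> ('x, 'v, 'e) graph_field \<Rightarrow> ('p, 'a, 'b, 'c) rel_graph \<Rightarrow>
   ('x, 'v, 'e, 'p, 'a, 'b, 'c) rep_map \<Rightarrow> ('x \<times> 'x) set" where
  "vertex_generated X A D \<rho> =
     gen_equiv (space X)
       (\<Union>P\<in>verts (graph_of D). map_prod (ident A \<rho> P) (ident A \<rho> P) ` vrel D P)"

definition edge_generated ::
  "'x measure \<Rightarrow> ('x, 'v, 'e) graph_field \<Rightarrow> ('p, 'a, 'b, 'c) rel_graph \<Rightarrow> 'a set \<Rightarrow>
   ('p, 'a) pre_digraph \<Rightarrow> ('x, 'v, 'e, 'p, 'a, 'b, 'c) rep_map \<Rightarrow> ('a \<Rightarrow> 'x \<rightharpoonup> 'x) \<Rightarrow>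
   ('x \<times> 'x) set" where
  "edge_generated X A D Or T \<rho> \<phi> =
     gen_equiv (space X) (\<Union>a\<in>arcs (graph_of D). full_phi A D Or T \<rho> \<phi> a)"

end

theory Submission
  imports Defs
begin

text \<open>
  Every vertex \<open>v\<close> of the arboretum is equivalent to some representative \<open>w\<close>.  Modulo \<open>R'\<close> the base
  point of \<open>w\<close> depends only on \<open>v\<close>, and this invariant of \<open>v\<close> is constant on \<open>R\<close>-orbits.  The two ends
  of an edge have invariants that agree modulo \<open>R''\<close>, because the edge is equivalent to an edge of the
  representing tree or to some \<open>s_a(x)\<close>.  As the fibres are connected, modulo \<open>R'\<close> and \<open>R''\<close> the
  invariant depends only on the fibre.  The root is represented over every \<open>x\<close> and its vertex there
  has invariant \<open>x\<close>; so \<open>R\<close>-equivalent points of \<open>X\<close> are equivalent modulo \<open>R'\<close> and \<open>R''\<close>.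
\<close>

section \<open>Serre graphs: attaching a leaf to a tree, spanning maximal subtrees\<close>

lemma serre_graph_iff:
  "serre_graph G bar \<longleftrightarrow> wf_digraph G \<and>
     (\<forall>a\<in>arcs G. bar a \<in> arcs G \<and> bar a \<noteq> a \<and> bar (bar a) = a \<and> tail G (bar a) = head G a)"
  (is "_ \<longleftrightarrow> ?rhs")
proof
  let ?r = "\<lambda>e. if e \<in> arcs G then bar e else e"
  assume "serre_graph G bar"
  then interpret bidirected_digraph G ?r by (simp add: serre_graph_def)
  have "bar a \<in> arcs G \<and> bar a \<noteq> a \<and> bar (bar a) = a \<and> tail G (bar a) = head G a"
    if "a \<in> arcs G" for a
    using that arev_in_arcs[of a] arev_dom[of a] arev_arev[of a] tail_arev[of a] by simp
  then show ?rhs using wf_digraph_axioms by blast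
next
  assume ?rhs
  then show "serre_graph G bar"
    unfolding serre_graph_def by (intro wf_digraph.bidirected_digraphI) auto
qed

lemma serre_graph_head_bar:
  assumes "serre_graph G bar" "a \<in> arcs G"
  shows "head G (bar a) = tail G a"
  using assms unfolding serre_graph_iff by metis

lemma (in pre_digraph) cas_consecutive:
  "cas u (xs @ a # b # ys) v \<Longrightarrow> tail G b = head G a"
  by (induction xs arbitrary: u) auto

lemma (in pre_digraph) cas_last:
  "cas u (xs @ [a]) v \<Longrightarrow> head G a = v"
  by (induction xs arbitrary: u) auto

text \<open>In the enlarged graph \<open>e\<close> is the only edge arriving at the new vertex
  \<open>head G e\<close>, and \<open>bar e\<close> the only one leaving it. A circuit through that
  vertex would have to backtrack or to visit the other end of \<open>e\<close> twice, so no circuit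
  arises that was not already in \<open>T\<close>.\<close>

lemma serre_tree_add_leaf:
  assumes G: "serre_graph G bar" and T: "serre_tree T bar" and sub: "subgraph T G"
    and e: "e \<in> arcs G" "tail G e \<in> verts T" "head G e \<notin> verts T"
  defines "T' \<equiv> \<lparr>verts = insert (head G e) (verts T), arcs = arcs T \<union> {e, bar e},
                 tail = tail G, head = head G\<rparr>"
  shows "serre_tree T' bar" "subgraph T' G" "subgraph T T'"
proof -
  have [simp]: "tail T = tail G" "head T = head G"
    using sub by (auto simp: subgraph_def compatible_def)
  have T'_simps [simp]: "verts T' = insert (head G e) (verts T)" "arcs T' = arcs T \<union> {e, bar e}"
    "tail T' = tail G" "head T' = head G"
    by (simp_all add: T'_def)
  have sT: "serre_graph T bar" and cT: "strongly_connected T" and nT: "\<nexists>p. circuit T bar p"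
    using T by (auto simp: serre_tree_def)
  have wfT: "wf_digraph T" using sT by (simp add: serre_graph_iff)
  have wfG: "wf_digraph G" using G by (simp add: serre_graph_iff)
  have bar_e: "bar e \<in> arcs G" "bar e \<noteq> e" "bar (bar e) = e"
    "tail G (bar e) = head G e" "head G (bar e) = tail G e"
    using G e serre_graph_head_bar[OF G] by (auto simp: serre_graph_iff)
  have T_ends: "tail G a \<in> verts T" "head G a \<in> verts T" if "a \<in> arcs T" for a
    using wf_digraph.wellformed[OF wfT that] by simp_all
  have wfT': "wf_digraph T'"
    using T_ends e bar_e by unfold_locales auto
  show subT': "subgraph T' G"
    using sub e bar_e wfT' wfG wf_digraph.wellformed[OF wfG]
    by (auto simp: subgraph_def compatible_def)
  show sub_T': "subgraph T T'"
    using wfT wfT' by (auto simp: subgraph_def compatible_def)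
  have sT': "serre_graph T' bar"
    using sT wfT' bar_e by (auto simp: serre_graph_iff)
  interpret T': wf_digraph T' by (fact wfT')
  have reach_T: "x \<rightarrow>\<^sup>*\<^bsub>T'\<^esub> y" if "x \<in> verts T" "y \<in> verts T" for x y
    using cT that sub_T' pre_digraph.reachable_mono unfolding strongly_connected_def by metis
  have "tail G e \<rightarrow>\<^bsub>T'\<^esub> head G e" "head G e \<rightarrow>\<^bsub>T'\<^esub> tail G e"
    using T'.in_arcs_imp_in_arcs_ends[of e] T'.in_arcs_imp_in_arcs_ends[of "bar e"] bar_e by auto
  then have reach_e: "tail G e \<rightarrow>\<^sup>*\<^bsub>T'\<^esub> head G e" "head G e \<rightarrow>\<^sup>*\<^bsub>T'\<^esub> tail G e"
    by auto
  have hub: "x \<rightarrow>\<^sup>*\<^bsub>T'\<^esub> tail G e" "tail G e \<rightarrow>\<^sup>*\<^bsub>T'\<^esub> x" if "x \<in> verts T'" for x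
    using that reach_T[of x "tail G e"] reach_T[of "tail G e" x] reach_e e(2) by auto
  have "x \<rightarrow>\<^sup>*\<^bsub>T'\<^esub> y" if "x \<in> verts T'" "y \<in> verts T'" for x y
    using T'.reachable_trans[OF hub(1)[OF that(1)] hub(2)[OF that(2)]] .
  then have cT': "strongly_connected T'"
    unfolding strongly_connected_def by (metis T'_simps(1) insert_not_empty)
  have "\<not> circuit T' bar p" for p
  proof
    assume "circuit T' bar p"
    then obtain u where p: "T'.awalk u p u" "distinct (tl (T'.awalk_verts u p))" "p \<noteq> []"
      and succ: "successively (\<lambda>a b. b \<noteq> bar a) p"
      by (auto simp: circuit_def T'.cycle_def)
    have cas: "T'.cas u p u" and arcs_p: "set p \<subseteq> arcs T'" using p(1) by (simp_all only: T'.awalk_def)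
    \<comment> \<open>The vertices of a walk after its starting point are the heads of its arcs, so
      a circuit uses no head twice.\<close>
    have dist: "distinct (map (head G) p)"
      using p T'.awalk_verts_conv'[OF cas] by simp
    have head_leaf: "a = e" if "a \<in> arcs T'" "head G a = head G e" for a
      using that T_ends(2)[of a] e bar_e by auto
    have tail_leaf: "a = bar e" if "a \<in> arcs T'" "tail G a = head G e" for a
      using that T_ends(1)[of a] e bar_e by auto
    \<comment> \<open>An edge following \<open>e\<close> leaves the new vertex, hence is
      \<open>bar e\<close>: a backtrack. If \<open>e\<close> comes last, the circuit is based at the
      new vertex and, as \<open>e\<close> alone is not closed, starts with \<open>bar e\<close>.
      This leaves the backtrack \<open>[bar e, e]\<close>, or else \<open>bar e\<close> and the edge
      before the final \<open>e\<close> share the head \<open>tail G e\<close>.\<close>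
    have "e \<notin> set p"
    proof
      assume "e \<in> set p"
      then obtain xs ys where split: "p = xs @ e # ys" by (meson split_list)
      show False
      proof (cases ys)
        case (Cons y ys')
        then have "tail G y = head G e"
          using cas split T'.cas_consecutive by auto
        then have "y = bar e" using tail_leaf arcs_p split Cons by auto
        then show False using succ split Cons by (auto simp: successively_append_iff)
      next
        case Nil
        then have u: "u = head G e" using cas split T'.cas_last by auto
        show False
        proof (cases xs)
          case Nil
          then show False using cas split \<open>ys = []\<close> u e by auto
        next
          case (Cons x zs)
          then have "x = bar e" using cas split u tail_leaf arcs_p by auto
          then have p_eq: "p = bar e # zs @ [e]" using split Cons \<open>ys = []\<close> by simp
          show False
          proof (cases zs rule: rev_cases)
            case Nil
            then show False using p_eq succ bar_e by simp
          next
            case (snoc zs' z)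
            then have "tail G e = head G z"
              using cas p_eq T'.cas_consecutive[of u "bar e # zs'" z e "[]" u] by simp
            then show False using dist p_eq snoc bar_e by simp
          qed
        qed
      qed
    qed
    \<comment> \<open>The edge before \<open>bar e\<close>, taken cyclically if \<open>bar e\<close>
      comes first, ends at the new vertex and so is \<open>e\<close>, which has just been
      excluded.\<close>
    moreover have "bar e \<notin> set p"
    proof
      assume "bar e \<in> set p"
      then obtain xs ys where split: "p = xs @ bar e # ys" by (meson split_list)
      show False
      proof (cases xs rule: rev_cases)
        case (snoc xs' x)
        then have "head G x = head G e"
          using cas split T'.cas_consecutive[of u xs' x "bar e" ys u] bar_e by simp
        then show False using head_leaf[of x] arcs_p split snoc \<open>e \<notin> set p\<close> by auto
      next
        case Nil
        then have u: "u = head G e" using cas split bar_e by simp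
        obtain q a where qa: "p = q @ [a]" using p(3) by (meson rev_exhaust)
        then have "head G a = head G e" using cas u T'.cas_last by auto
        then show False using head_leaf[of a] arcs_p qa \<open>e \<notin> set p\<close> by auto
      qed
    qed
    ultimately have "set p \<subseteq> arcs T" using arcs_p by auto
    moreover have "T'.cas v q w \<Longrightarrow> pre_digraph.cas T v q w" for v q w
      by (induction q arbitrary: v) (auto simp: pre_digraph.cas.simps)
    moreover have "pre_digraph.awalk_verts T u p = T'.awalk_verts u p"
      by (simp add: pre_digraph.awalk_verts_conv)
    moreover have "u \<in> verts T"
      using cas p(3) calculation(1) T_ends by (cases p) auto
    ultimately have "circuit T bar p"
      using p succ cas by (auto simp: circuit_def pre_digraph.cycle_def pre_digraph.awalk_def)
    then show False using nT by blast
  qed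
  then show "serre_tree T' bar" using sT' cT' by (auto simp: serre_tree_def)
qed

text \<open>A path of \<open>G\<close> from \<open>T\<close> to a vertex outside \<open>T\<close>
  has an edge leaving \<open>T\<close>; attaching it as a leaf gives a larger subtree, against
  maximality.\<close>

lemma maximal_subtree_spanning:
  assumes G: "serre_graph G bar" "strongly_connected G" and T: "maximal_subtree G bar T"
  shows "verts T = verts G"
proof (rule ccontr)
  assume neq: "verts T \<noteq> verts G"
  have sub: "subgraph T G" and tree: "serre_tree T bar"
    using T by (auto simp: maximal_subtree_def)
  obtain u where u: "u \<in> verts T"
    using tree by (auto simp: serre_tree_def strongly_connected_def)
  obtain w where w: "w \<in> verts G" "w \<notin> verts T" using neq sub by (auto simp: subgraph_def)
  interpret G: wf_digraph G using G(1) by (simp add: serre_graph_iff)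
  have "u \<rightarrow>\<^sup>*\<^bsub>G\<^esub> w" using G(2) u w sub by (auto simp: strongly_connected_def subgraph_def)
  \<comment> \<open>The disjunction makes the claim inductive along the path: either no edge has
    left \<open>T\<close> yet, or one has already been found.\<close>
  then have "w \<in> verts T \<or> (\<exists>e\<in>arcs G. tail G e \<in> verts T \<and> head G e \<notin> verts T)"
    by (induction rule: G.reachable_induct) (use u in auto)
  then obtain e where e: "e \<in> arcs G" "tail G e \<in> verts T" "head G e \<notin> verts T"
    using w by blast
  define T' where "T' = \<lparr>verts = insert (head G e) (verts T), arcs = arcs T \<union> {e, bar e},
    tail = tail G, head = head G\<rparr>"
  have "serre_tree T' bar" "subgraph T' G" "subgraph T T'"
    unfolding T'_def by (rule serre_tree_add_leaf[OF G(1) tree sub e])+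
  then have "T' = T" using T by (auto simp: maximal_subtree_def)
  moreover have "head G e \<in> verts T'" by (simp add: T'_def)
  ultimately show False using e(3) by simp
qed

section \<open>Generated equivalence relations and orbit relations of actions\<close>

lemma gen_equiv_superset: "S \<subseteq> gen_equiv C S"
  by (auto simp: gen_equiv_def)

lemma gen_equiv_subset: "equiv C E \<Longrightarrow> S \<subseteq> E \<Longrightarrow> gen_equiv C S \<subseteq> E"
  by (auto simp: gen_equiv_def)

text \<open>An inclusion in an intersection is tested against one arbitrary member \<open>E\<close>.
  In the theorem this turns the inclusion of \<open>R\<close> into a statement about
  \<open>E\<close>, where symmetry and transitivity are at hand.\<close>

lemma subset_gen_equivI:
  "(\<And>E. equiv C E \<Longrightarrow> S \<subseteq> E \<Longrightarrow> B \<subseteq> E) \<Longrightarrow> B \<subseteq> gen_equiv C S"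
  by (auto simp: gen_equiv_def)

lemma refl_on_gen_equiv: "x \<in> C \<Longrightarrow> (x, x) \<in> gen_equiv C S"
  by (auto simp: gen_equiv_def equiv_def refl_on_def)

lemma space_disjoint_sum: "space (disjoint_sum I M) = (SIGMA i:I. space (M i))"
  unfolding disjoint_sum_def by (rule space_measure_of) auto

lemma orbit_rel_fibreI:
  assumes "rel_fibred_standard_space X R F" "(x, y) \<in> R" "f \<in> fibre F y"
  shows "(act F x y f, f) \<in> orbit_rel R F"
proof -
  have "act F x y f \<in> fibre F x"
    using assms by (simp add: rel_fibred_standard_space_def)
  then show ?thesis using assms(2,3) by (simp add: orbit_rel_def fibre_def)
qed

text \<open>The unit law of the action gives reflexivity, the composition law transitivity, and both
  together symmetry, each along with the same property of \<open>R\<close>.\<close>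

lemma equiv_orbit_rel:
  assumes R: "equiv (space X) R" and F: "rel_fibred_standard_space X R F"
  shows "equiv (space (carr F)) (orbit_rel R F)"
proof (rule equivI)
  have proj: "proj F f \<in> space X" if "f \<in> space (carr F)" for f
    using F that by (auto simp: rel_fibred_standard_space_def fibred_standard_space_def)
  have act: "act F x x f = f" if "f \<in> fibre F x" "x \<in> space X" for x f
    using F that by (simp add: rel_fibred_standard_space_def)
  have act_act: "act F x y (act F y z f) = act F x z f"
    if "(x, y) \<in> R" "(y, z) \<in> R" "f \<in> fibre F z" for x y z f
    using F that unfolding rel_fibred_standard_space_def by blast
  have sym_R: "(y, x) \<in> R" if "(x, y) \<in> R" for x y
    using R that by (meson equivE symD)
  have trans_R: "(x, z) \<in> R" if "(x, y) \<in> R" "(y, z) \<in> R" for x y z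
    using R that by (meson equivE transD)
  have refl_R: "(x, x) \<in> R" if "x \<in> space X" for x
    using R that by (meson equivE refl_onD)
  show "orbit_rel R F \<subseteq> space (carr F) \<times> space (carr F)"
    by (auto simp: orbit_rel_def)
  show "refl_on (space (carr F)) (orbit_rel R F)"
    using proj refl_R act by (auto simp: refl_on_def orbit_rel_def fibre_def)
  show "sym (orbit_rel R F)"
  proof (rule symI)
    fix f g assume fg: "(f, g) \<in> orbit_rel R F"
    then have R: "(proj F f, proj F g) \<in> R" and g: "g \<in> fibre F (proj F g)"
      and eq: "act F (proj F f) (proj F g) g = f"
      by (auto simp: orbit_rel_def fibre_def)
    have "act F (proj F g) (proj F f) f = g"
      using act_act[OF sym_R[OF R] R g] act[OF g] proj[of g] g eq by (simp add: fibre_def)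
    then show "(g, f) \<in> orbit_rel R F"
      using fg sym_R[OF R] by (auto simp: orbit_rel_def)
  qed
  show "trans (orbit_rel R F)"
  proof (rule transI)
    fix f g h assume fg: "(f, g) \<in> orbit_rel R F" and gh: "(g, h) \<in> orbit_rel R F"
    then have R: "(proj F f, proj F g) \<in> R" "(proj F g, proj F h) \<in> R"
      and h: "h \<in> fibre F (proj F h)"
      by (auto simp: orbit_rel_def fibre_def)
    have "act F (proj F f) (proj F h) h = f"
      using act_act[OF R h] fg gh by (simp add: orbit_rel_def)
    then show "(f, h) \<in> orbit_rel R F"
      using fg gh trans_R[OF R] by (auto simp: orbit_rel_def)
  qed
qed

text \<open>This is equivariance of \<open>h\<close>. Applied to \<open>org A\<close> and
  \<open>ter A\<close>, it carries a claim that depends only on the orbits of the two ends from one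
  edge to its whole orbit.\<close>

lemma morphism_orbit_rel:
  assumes "morphism R F G h" "(f, g) \<in> orbit_rel R F"
  shows "(h f, h g) \<in> orbit_rel R G"
proof -
  have fg: "f \<in> space (carr F)" "g \<in> space (carr F)" "(proj F f, proj F g) \<in> R"
    "act F (proj F f) (proj F g) g = f"
    using assms(2) by (auto simp: orbit_rel_def)
  have "h f \<in> space (carr G)" "h g \<in> space (carr G)"
    using assms(1) fg by (auto simp: morphism_def dest: measurable_space)
  moreover have "proj G (h f) = proj F f" "proj G (h g) = proj F g"
    using assms(1) fg by (auto simp: morphism_def)
  moreover have "h (act F (proj F f) (proj F g) g) = act G (proj F f) (proj F g) (h g)"
    using assms(1) fg(2,3) by (simp add: morphism_def fibre_def)
  ultimately show ?thesis using fg by (simp add: orbit_rel_def)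
qed

section \<open>Representations of rooted trees of relations\<close>

lemma vrep_induced [simp]: "vrep (induced_rel_graph D T) \<rho> = vrep D \<rho>"
  by (simp add: fun_eq_iff vrep_def induced_rel_graph_def)

lemma erep_induced [simp]: "erep (induced_rel_graph D T) \<rho> = erep D \<rho>"
  by (simp add: fun_eq_iff erep_def induced_rel_graph_def)

lemma graph_of_induced [simp]: "graph_of (induced_rel_graph D T) = T"
  and vrel_induced [simp]: "vrel (induced_rel_graph D T) = vrel D"
  and vspace_induced [simp]: "vspace (induced_rel_graph D T) = vspace D"
  by (simp_all add: induced_rel_graph_def)

lemma vrep_subset_space:
  assumes "representation X R A D P0 Y \<rho>" "P \<in> verts (graph_of D)"
  shows "vrep D \<rho> P \<subseteq> space (carr (vtx A))"
proof -
  let ?M = "restrict_space (carr (vtx A)) (vrep D \<rho> P)"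
  have "bij_betw (\<lambda>u. vmap \<rho> (P, u)) (space (vspace D P)) (space ?M)"
    using assms by (auto simp: representation_def rel_iso_def borel_iso_def)
  then have "vrep D \<rho> P = space ?M" by (simp add: bij_betw_def vrep_def)
  then show ?thesis by (auto simp: space_restrict_space)
qed

text \<open>The representation carries \<open>vrel D P\<close> onto the restricted orbit relation,
  and \<open>ident A \<rho> P\<close> is the representation followed by the projection. The
  generators of \<open>R'\<close> thus become pairs of base points of orbit-equivalent
  representatives, the form in which both inclusions use them.\<close>

lemma ident_image_vrel:
  assumes "representation X R A D P0 Y \<rho>" "P \<in> verts (graph_of D)" "borel_equiv_rel (vspace D P) (vrel D P)"
  shows "map_prod (ident A \<rho> P) (ident A \<rho> P) ` vrel D P =
    map_prod (proj (vtx A)) (proj (vtx A)) `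
      (orbit_rel R (vtx A) \<inter> vrep D \<rho> P \<times> vrep D \<rho> P)"
proof -
  let ?f = "\<lambda>u. vmap \<rho> (P, u)"
  have iff: "(u, v) \<in> vrel D P \<longleftrightarrow>
      (?f u, ?f v) \<in> orbit_rel R (vtx A) \<inter> vrep D \<rho> P \<times> vrep D \<rho> P"
    if "u \<in> space (vspace D P)" "v \<in> space (vspace D P)" for u v
    using assms(1,2) that unfolding representation_def rel_iso_def by blast
  have sub: "vrel D P \<subseteq> space (vspace D P) \<times> space (vspace D P)"
    using assms(3) by (auto simp: borel_equiv_rel_def equiv_def)
  have "map_prod ?f ?f ` vrel D P = orbit_rel R (vtx A) \<inter> vrep D \<rho> P \<times> vrep D \<rho> P"
  proof
    show "map_prod ?f ?f ` vrel D P \<subseteq> orbit_rel R (vtx A) \<inter> vrep D \<rho> P \<times> vrep D \<rho> P"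
      using iff sub by auto
    show "orbit_rel R (vtx A) \<inter> vrep D \<rho> P \<times> vrep D \<rho> P \<subseteq> map_prod ?f ?f ` vrel D P"
    proof
      fix p assume p: "p \<in> orbit_rel R (vtx A) \<inter> vrep D \<rho> P \<times> vrep D \<rho> P"
      then obtain u v where "p = (?f u, ?f v)" "u \<in> space (vspace D P)" "v \<in> space (vspace D P)"
        by (auto simp: vrep_def)
      then show "p \<in> map_prod ?f ?f ` vrel D P"
        using iff[of u v] p by force
    qed
  qed
  then have "map_prod (proj (vtx A)) (proj (vtx A)) ` map_prod ?f ?f ` vrel D P =
      map_prod (proj (vtx A)) (proj (vtx A)) `
        (orbit_rel R (vtx A) \<inter> vrep D \<rho> P \<times> vrep D \<rho> P)"
    by simp
  then show ?thesis by (simp add: image_image map_prod_def ident_def case_prod_beta)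
qed

text \<open>The representation commutes with both endpoint maps, so the claim is read off in the
  tree of relations. There the origin of \<open>(a, u)\<close> is given by
  \<open>inj_map D (bar_of D a)\<close>, whose values lie in the space at the head of
  \<open>bar_of D a\<close>, that is, at the tail of \<open>a\<close>.\<close>

lemma erep_endpoints:
  assumes D: "graph_of_relations D" and rep: "representation X R A D P0 Y \<rho>"
    and a: "a \<in> arcs (graph_of D)" and e: "e \<in> erep D \<rho> a"
  shows "org A e \<in> vrep D \<rho> (tail (graph_of D) a)" "ter A e \<in> vrep D \<rho> (head (graph_of D) a)"
proof -
  obtain u where u: "u \<in> space (espace D a)" "e = emap \<rho> (a, u)"
    using e by (auto simp: erep_def)
  obtain V E where iso: "graph_field_iso_onto (vspace D P0) (tree_arboretum D P0) X A Y V E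
      (base_map \<rho>) (vmap \<rho>) (emap \<rho>)"
    using rep unfolding representation_def by blast
  have "(a, u) \<in> space (carr (edg (tree_arboretum D P0)))"
    using u a by (simp add: tree_arboretum_def total_espace_def space_disjoint_sum)
  then have ends: "org A e = vmap \<rho> (edge_origin D (a, u))" "ter A e = vmap \<rho> (edge_terminus D (a, u))"
    using iso u by (simp_all add: graph_field_iso_onto_def tree_arboretum_def)
  have graph: "serre_graph (graph_of D) (bar_of D)" using D by (simp add: graph_of_relations_def)
  have bar: "bar_of D a \<in> arcs (graph_of D)" using graph a by (simp add: serre_graph_iff)
  have head: "inj_map D b v \<in> space (vspace D (head (graph_of D) b))"
    if "b \<in> arcs (graph_of D)" "v \<in> space (espace D b)" for b v
    using D that by (auto simp: graph_of_relations_def dest: measurable_space)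
  have "sets (espace D (bar_of D a)) = sets (espace D a)"
    using D a by (simp add: graph_of_relations_def)
  then have "inj_map D (bar_of D a) u \<in> space (vspace D (tail (graph_of D) a))"
    using head[OF bar, of u] u sets_eq_imp_space_eq serre_graph_head_bar[OF graph a] by metis
  then show "org A e \<in> vrep D \<rho> (tail (graph_of D) a)"
    using ends by (auto simp: edge_origin_def vrep_def)
  show "ter A e \<in> vrep D \<rho> (head (graph_of D) a)"
    using head[OF a, of u] u ends by (auto simp: edge_terminus_def vrep_def)
qed

text \<open>A fundamental domain meets the class of \<open>(P0, u)\<close> in one point only, and
  the root space already contains \<open>(P0, u)\<close> itself.\<close>

lemma root_proj_root:
  assumes D: "rooted_tree_of_relations D P0" and u: "u \<in> space (vspace D P0)"
  shows "root_proj D P0 (P0, u) = u"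
proof -
  let ?E = "tree_rel D" and ?S = "{P0} \<times> space (vspace D P0)"
  have P0: "P0 \<in> verts (graph_of D)" using D by (simp add: rooted_tree_of_relations_def)
  have in_space: "(P0, u) \<in> space (total_vspace D)"
    using P0 u by (simp add: total_vspace_def space_disjoint_sum)
  then have refl: "((P0, u), (P0, u)) \<in> ?E" by (simp add: tree_rel_def refl_on_gen_equiv)
  have "is_singleton (?E `` {(P0, u)} \<inter> ?S)"
    using D quotientI[OF in_space]
    by (simp add: rooted_tree_of_relations_def fundamental_domain_def)
  then obtain p where p: "?E `` {(P0, u)} \<inter> ?S = {p}" by (rule is_singletonE)
  have "w = u" if "w \<in> space (vspace D P0)" "((P0, u), (P0, w)) \<in> ?E" for w
  proof -
    have "(P0, u) \<in> ?E `` {(P0, u)} \<inter> ?S" "(P0, w) \<in> ?E `` {(P0, u)} \<inter> ?S"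
      using refl u that by simp_all
    then show ?thesis unfolding p by blast
  qed
  then show ?thesis unfolding root_proj_def using u refl by (intro the_equality) auto
qed

text \<open>The representatives at the root form a section over all of \<open>X\<close>: the vertex
  \<open>vmap \<rho> (P0, u)\<close> lies over \<open>base_map \<rho> u\<close>, and
  \<open>base_map \<rho>\<close> maps onto \<open>X\<close>.\<close>

lemma vrep_root_section:
  assumes D: "rooted_tree_of_relations D P0" and rep: "representation X R A D P0 (space X) \<rho>"
    and x: "x \<in> space X"
  obtains w where "w \<in> vrep D \<rho> P0" "proj (vtx A) w = x"
proof -
  obtain V E where iso: "graph_field_iso_onto (vspace D P0) (tree_arboretum D P0) X A (space X) V E
      (base_map \<rho>) (vmap \<rho>) (emap \<rho>)"
    using rep unfolding representation_def by blast
  then have "bij_betw (base_map \<rho>) (space (vspace D P0)) (space (restrict_space X (space X)))"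
    by (simp add: graph_field_iso_onto_def borel_iso_def)
  then have "base_map \<rho> ` space (vspace D P0) = space X"
    by (simp add: bij_betw_def space_restrict_space)
  with x have "x \<in> base_map \<rho> ` space (vspace D P0)" by simp
  then obtain u where u: "u \<in> space (vspace D P0)" "base_map \<rho> u = x" by (elim imageE) simp
  have "(P0, u) \<in> space (total_vspace D)"
    using D u by (simp add: rooted_tree_of_relations_def total_vspace_def space_disjoint_sum)
  then have "proj (vtx A) (vmap \<rho> (P0, u)) = base_map \<rho> (root_proj D P0 (P0, u))"
    using iso by (simp add: graph_field_iso_onto_def tree_arboretum_def)
  then have "proj (vtx A) (vmap \<rho> (P0, u)) = x" using root_proj_root[OF D u(1)] u by simp
  with u that show ?thesis by (auto simp: vrep_def)
qed

section \<open>Edges of the arboretum and the data of a desingularization\<close>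

lemma borel_graph_field_edge:
  assumes A: "borel_graph_field X R A" and e: "e \<in> space (carr (edg A))"
  shows "org A e \<in> fibre (vtx A) (proj (edg A) e)" "ter A e \<in> fibre (vtx A) (proj (edg A) e)"
    "org A (opp A e) = ter A e" "ter A (opp A e) = org A e"
proof -
  have "morphism R (edg A) (vtx A) (org A)" "morphism R (edg A) (vtx A) (ter A)"
    using A by (simp_all add: borel_graph_field_def)
  then show "org A e \<in> fibre (vtx A) (proj (edg A) e)" "ter A e \<in> fibre (vtx A) (proj (edg A) e)"
    using e measurable_space unfolding morphism_def fibre_def by fast+
  \<comment> \<open>That \<open>opp A\<close> exchanges the ends is known fibre by fibre, so the
    edge is viewed in the graph over its own base point.\<close>
  let ?G = "field_fibre A (proj (edg A) e)"
  have "proj (edg A) e \<in> space X"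
    using A e measurable_space
    unfolding borel_graph_field_def rel_fibred_standard_space_def fibred_standard_space_def by fast
  then have G: "serre_graph ?G (opp A)" using A by (simp add: borel_graph_field_def)
  have "e \<in> arcs ?G" using e by (simp add: field_fibre_def subfield_fibre_def fibre_def)
  then have "tail ?G (opp A e) = head ?G e" "head ?G (opp A e) = tail ?G e"
    using G serre_graph_head_bar[OF G] by (simp_all add: serre_graph_iff)
  then show "org A (opp A e) = ter A e" "ter A (opp A e) = org A e"
    by (simp_all add: field_fibre_def subfield_fibre_def)
qed

text \<open>The subtree spans, so the representation and the partition of the vertex field, given
  over \<open>T\<close>, reach every vertex of \<open>graph_of D\<close>, as the generators of
  \<open>R'\<close> require.\<close>

lemma desingularizationE:
  assumes "desingularization X R A D Or T P0 \<rho> \<phi>"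
  obtains s where "graph_of_relations D" "orientation (graph_of D) (bar_of D) Or"
    "graph_of_relations (induced_rel_graph D T)" "serre_tree T (bar_of D)"
    "verts T = verts (graph_of D)" "tail T = tail (graph_of D)" "head T = head (graph_of D)"
    "rooted_tree_of_relations (induced_rel_graph D T) P0"
    "representation X R A (induced_rel_graph D T) P0 (space X) \<rho>"
    "saturations_partition (carr (vtx A)) (orbit_rel R (vtx A)) (verts (graph_of D)) (vrep D \<rho>)"
    "\<forall>a\<in>Or - arcs T. edge_representation X R A D \<rho> a (\<phi> a) (s a)"
    "saturations_partition (carr (edg A)) (orbit_rel R (edg A)) (arcs (graph_of D))
       (full_erep A D Or T \<rho> \<phi> s)"
proof -
  have D: "graph_of_relations D" "strongly_connected (graph_of D)"
    and T: "maximal_subtree (graph_of D) (bar_of D) T"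
    using assms by (simp_all add: desingularization_def)
  have "serre_graph (graph_of D) (bar_of D)" using D by (simp add: graph_of_relations_def)
  then have verts: "verts T = verts (graph_of D)"
    using maximal_subtree_spanning D(2) T by blast
  have "tail T = tail (graph_of D)" "head T = head (graph_of D)" "serre_tree T (bar_of D)"
    using T by (auto simp: maximal_subtree_def subgraph_def compatible_def)
  moreover have "orientation (graph_of D) (bar_of D) Or"
    and reps: "arboretum_of_representatives X R A (induced_rel_graph D T) P0 (space X) \<rho>"
    using assms by (simp_all add: desingularization_def)
  moreover have "rooted_tree_of_relations (induced_rel_graph D T) P0"
    "representation X R A (induced_rel_graph D T) P0 (space X) \<rho>"
    "saturations_partition (carr (vtx A)) (orbit_rel R (vtx A)) (verts (graph_of D)) (vrep D \<rho>)"
    using reps verts by (simp_all add: arboretum_of_representatives_def)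
  moreover have "graph_of_relations (induced_rel_graph D T)"
    using reps by (simp add: arboretum_of_representatives_def rooted_tree_of_relations_def)
  moreover obtain s where "\<forall>a\<in>Or - arcs T. edge_representation X R A D \<rho> a (\<phi> a) (s a)"
    "saturations_partition (carr (edg A)) (orbit_rel R (edg A)) (arcs (graph_of D))
       (full_erep A D Or T \<rho> \<phi> s)"
    using assms unfolding desingularization_def by blast
  ultimately show thesis using that[of s] D(1) verts by blast
qed

text \<open>The subtree is closed under inversion. Hence the section and the partial isomorphism
  that \<open>full_erep\<close> and \<open>full_phi\<close> use for an edge against the orientation
  belong to an edge for which \<open>edge_representation\<close> is assumed.\<close>

lemma orientation_bar:
  assumes G: "serre_graph G bar" and T: "serre_graph T bar" and Or: "orientation G bar Or"
    and a: "a \<in> arcs G" "a \<notin> arcs T" "a \<notin> Or"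
  shows "bar a \<in> Or - arcs T"
proof -
  have "bar a \<in> Or" using Or a by (simp add: orientation_def)
  moreover have "bar a \<notin> arcs T"
  proof
    assume "bar a \<in> arcs T"
    then have "bar (bar a) \<in> arcs T" using T by (simp add: serre_graph_iff)
    then show False using G a by (simp add: serre_graph_iff)
  qed
  ultimately show ?thesis by simp
qed

section \<open>The generators lie in \<open>R\<close>\<close>

text \<open>Base points of orbit-equivalent vertices are \<open>R\<close>-equivalent, which settles
  the vertex relations. As for the edges, those of the subtree give restrictions of the identity,
  the other oriented ones elements of the pseudogroup, and the rest inverses of such
  elements.\<close>

lemma generators_subset:
  assumes R: "borel_equiv_rel X R" and A: "borel_graph_field X R A"
    and d: "desingularization X R A D Or T P0 \<rho> \<phi>"
  shows "vertex_generated X A D \<rho> \<subseteq> R" "edge_generated X A D Or T \<rho> \<phi> \<subseteq> R"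
proof -
  obtain s where D: "graph_of_relations D" and Or: "orientation (graph_of D) (bar_of D) Or"
    and T: "serre_tree T (bar_of D)" "verts T = verts (graph_of D)" "tail T = tail (graph_of D)"
    and rep: "representation X R A (induced_rel_graph D T) P0 (space X) \<rho>"
    and edges: "\<forall>a\<in>Or - arcs T. edge_representation X R A D \<rho> a (\<phi> a) (s a)"
    using d by (elim desingularizationE) blast
  note edge = edges[rule_format]
  have G: "serre_graph (graph_of D) (bar_of D)" using D by (simp add: graph_of_relations_def)
  have sT: "serre_graph T (bar_of D)" using T(1) by (simp add: serre_tree_def)
  have eqR: "equiv (space X) R" using R by (simp add: borel_equiv_rel_def)
  have "map_prod (ident A \<rho> P) (ident A \<rho> P) ` vrel D P \<subseteq> R" if "P \<in> verts (graph_of D)" for P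
    using ident_image_vrel[OF rep, of P] that D T(2)
    by (auto simp: orbit_rel_def graph_of_relations_def ident_def induced_rel_graph_def)
  then show "vertex_generated X A D \<rho> \<subseteq> R"
    unfolding vertex_generated_def by (intro gen_equiv_subset[OF eqR]) blast
  have "full_phi A D Or T \<rho> \<phi> a \<subseteq> R" if a: "a \<in> arcs (graph_of D)" for a
  proof -
    have phi: "Map.graph (\<phi> b) \<subseteq> R" if "b \<in> Or - arcs T" for b
      using edge[OF that] by (simp add: edge_representation_def full_pseudogroup_def)
    \<comment> \<open>This concerns the edges of the subtree: the identity on the projection of a
      represented set lies in \<open>R\<close> by reflexivity, once that projection is known to lie
      in \<open>X\<close>.\<close>
    have "tail (graph_of D) a \<in> verts T"
      using G a T(2) wf_digraph.tail_in_verts by (auto simp: serre_graph_iff)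
    then have "vrep D \<rho> (tail (graph_of D) a) \<subseteq> space (carr (vtx A))"
      using vrep_subset_space[OF rep] by simp
    then have "proj (vtx A) ` vrep D \<rho> (tail (graph_of D) a) \<subseteq> space X"
      using A by (auto simp: borel_graph_field_def rel_fibred_standard_space_def
          fibred_standard_space_def)
    moreover have "refl_on (space X) R" "sym R" using eqR by (auto elim: equivE)
    ultimately show ?thesis
      using phi[of a] phi[of "bar_of D a"] orientation_bar[OF G sT Or a]
      by (auto simp: full_phi_def dest: refl_onD intro: symD)
  qed
  then show "edge_generated X A D Or T \<rho> \<phi> \<subseteq> R"
    unfolding edge_generated_def by (intro gen_equiv_subset[OF eqR]) blast
qed

section \<open>The inclusion of \<open>R\<close> in every equivalence relation above the
  generators\<close>

lemma subset_generated:
  assumes R: "borel_equiv_rel X R" and A: "arboretum X R A"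
    and d: "desingularization X R A D Or T P0 \<rho> \<phi>"
    and F: "equiv (space X) F" "vertex_generated X A D \<rho> \<subseteq> F" "edge_generated X A D Or T \<rho> \<phi> \<subseteq> F"
  shows "R \<subseteq> F"
proof -
  obtain s where D: "graph_of_relations D" and Or: "orientation (graph_of D) (bar_of D) Or"
    and DT: "graph_of_relations (induced_rel_graph D T)"
    and T: "serre_tree T (bar_of D)" "verts T = verts (graph_of D)" "tail T = tail (graph_of D)"
      "head T = head (graph_of D)"
    and root: "rooted_tree_of_relations (induced_rel_graph D T) P0"
    and rep: "representation X R A (induced_rel_graph D T) P0 (space X) \<rho>"
    and vpart: "saturations_partition (carr (vtx A)) (orbit_rel R (vtx A)) (verts (graph_of D))
      (vrep D \<rho>)"
    and edges: "\<forall>a\<in>Or - arcs T. edge_representation X R A D \<rho> a (\<phi> a) (s a)"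
    and epart: "saturations_partition (carr (edg A)) (orbit_rel R (edg A)) (arcs (graph_of D))
       (full_erep A D Or T \<rho> \<phi> s)"
    using d by (elim desingularizationE) blast
  note edge = edges[rule_format]
  have G: "serre_graph (graph_of D) (bar_of D)" using D by (simp add: graph_of_relations_def)
  have sT: "serre_graph T (bar_of D)" using T(1) by (simp add: serre_tree_def)
  have AG: "borel_graph_field X R A" using A by (simp add: arboretum_def)
  then have fib: "rel_fibred_standard_space X R (vtx A)" "rel_fibred_standard_space X R (edg A)"
    and morph: "morphism R (edg A) (vtx A) (org A)" "morphism R (edg A) (vtx A) (ter A)"
    by (auto simp: borel_graph_field_def)
  have eqR: "equiv (space X) R" using R by (simp add: borel_equiv_rel_def)
  have eqV: "equiv (space (carr (vtx A))) (orbit_rel R (vtx A))"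
    using equiv_orbit_rel[OF eqR fib(1)] .
  have reflV: "(v, v) \<in> orbit_rel R (vtx A)" if "v \<in> space (carr (vtx A))" for v
    using eqV that by (meson equivE refl_onD)
  have symV: "(w, v) \<in> orbit_rel R (vtx A)" if "(v, w) \<in> orbit_rel R (vtx A)" for v w
    using eqV that by (meson equivE symD)
  have transV: "(v, u) \<in> orbit_rel R (vtx A)"
    if "(v, w) \<in> orbit_rel R (vtx A)" "(w, u) \<in> orbit_rel R (vtx A)" for v w u
    using eqV that by (meson equivE transD)
  have symR: "(y, x) \<in> R" if "(x, y) \<in> R" for x y using eqR that by (meson equivE symD)
  have symF: "(y, x) \<in> F" if "(x, y) \<in> F" for x y using F(1) that by (meson equivE symD)
  have transF: "(x, z) \<in> F" if "(x, y) \<in> F" "(y, z) \<in> F" for x y z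
    using F(1) that by (meson equivE transD)
  have reflF: "(x, x) \<in> F" if "x \<in> space X" for x using F(1) that by (meson equivE refl_onD)
  have projV: "proj (vtx A) v \<in> space X" if "v \<in> space (carr (vtx A))" for v
    using fib(1) that measurable_space
    unfolding rel_fibred_standard_space_def fibred_standard_space_def by fast
  have arc_ends: "tail (graph_of D) a \<in> verts (graph_of D)" "head (graph_of D) a \<in> verts (graph_of D)"
    if "a \<in> arcs (graph_of D)" for a
    using G that wf_digraph.wellformed by (auto simp: serre_graph_iff)
  have vrep_space: "vrep D \<rho> P \<subseteq> space (carr (vtx A))" if "P \<in> verts (graph_of D)" for P
    using vrep_subset_space[OF rep, of P] that T(2) by simp
  have phiF: "full_phi A D Or T \<rho> \<phi> a \<subseteq> F" if "a \<in> arcs (graph_of D)" for a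
    using F(3) that gen_equiv_superset unfolding edge_generated_def by blast

  \<comment> \<open>The invariant of \<open>v\<close> is encoded as a relation: \<open>z\<close> is
    the base point of some representative in the orbit of \<open>v\<close>. An orbit may contain
    several representatives, so \<open>z\<close> is determined only modulo \<open>F\<close>.\<close>
  define rpt where "rpt v z \<longleftrightarrow> (\<exists>P\<in>verts (graph_of D). \<exists>w\<in>vrep D \<rho> P.
      (w, v) \<in> orbit_rel R (vtx A) \<and> z = proj (vtx A) w)" for v z
  have rpt_vrep: "rpt w (proj (vtx A) w)" if "P \<in> verts (graph_of D)" "w \<in> vrep D \<rho> P" for P w
    using that reflV vrep_space unfolding rpt_def by blast
  have rpt_orbit: "rpt v' z" if "rpt v z" "(v, v') \<in> orbit_rel R (vtx A)" for v v' z
    using that transV unfolding rpt_def by blast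
  \<comment> \<open>Disjointness of the saturations puts both representatives at the same vertex
    \<open>P\<close>. There they are orbit-equivalent, so their base points form a generating pair
    of \<open>R'\<close>.\<close>
  have rpt_unique: "(z, z') \<in> F" if z: "rpt v z" "rpt v z'" for v z z'
  proof -
    obtain P w P' w' where
      w: "P \<in> verts (graph_of D)" "w \<in> vrep D \<rho> P" "(w, v) \<in> orbit_rel R (vtx A)" "z = proj (vtx A) w"
      and w': "P' \<in> verts (graph_of D)" "w' \<in> vrep D \<rho> P'" "(w', v) \<in> orbit_rel R (vtx A)"
        "z' = proj (vtx A) w'"
      using z unfolding rpt_def by blast
    have "v \<in> orbit_rel R (vtx A) `` vrep D \<rho> P \<inter> orbit_rel R (vtx A) `` vrep D \<rho> P'"
      using w w' by blast
    then have "P' = P"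
      using vpart w(1) w'(1) by (auto simp: saturations_partition_def disjoint_family_on_def)
    moreover have "(w, w') \<in> orbit_rel R (vtx A)" using w(3) w'(3) symV transV by blast
    ultimately have "(z, z') \<in> map_prod (proj (vtx A)) (proj (vtx A)) `
        (orbit_rel R (vtx A) \<inter> vrep D \<rho> P \<times> vrep D \<rho> P)"
      using w w' by force
    also have "\<dots> = map_prod (ident A \<rho> P) (ident A \<rho> P) ` vrel D P"
      using ident_image_vrel[OF rep, of P] w(1) T(2) D by (simp add: graph_of_relations_def)
    also have "\<dots> \<subseteq> vertex_generated X A D \<rho>"
      unfolding vertex_generated_def using w(1) by (intro order_trans[OF _ gen_equiv_superset]) blast
    finally show ?thesis using F(2) by blast
  qed

  \<comment> \<open>One related pair of invariants suffices, since \<open>rpt_unique\<close> then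
    relates all others. The existential also supplies an invariant at each vertex along a
    path.\<close>
  define linked where "linked v v' \<longleftrightarrow> (\<exists>z z'. rpt v z \<and> rpt v' z' \<and> (z, z') \<in> F)" for v v'
  have linked_sym: "linked v' v" if "linked v v'" for v v'
    using that symF unfolding linked_def by blast
  \<comment> \<open>The origin of \<open>s a x\<close> is itself a representative, with base point
    \<open>x\<close>. The terminus is moved to one by translating it to the fibre over
    \<open>y\<close>, the value of \<open>\<phi> a\<close> at \<open>x\<close>, so \<open>y\<close>
    is an invariant of it; and \<open>(x, y)\<close> lies in the graph of a generator of
    \<open>R''\<close>.\<close>
  have section_linked: "s a x \<in> space (carr (edg A)) \<and> linked (org A (s a x)) (ter A (s a x))"
    if a: "a \<in> Or - arcs T" and x: "x \<in> dom (\<phi> a)" for a x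
  proof -
    have aG: "a \<in> arcs (graph_of D)" using a Or by (auto simp: orientation_def)
    obtain y where y: "\<phi> a x = Some y" using x by auto
    have "dom (\<phi> a) \<subseteq> space X" and sec: "partial_section X (edg A) (dom (\<phi> a)) (s a)"
      using edge[OF a]
      by (auto simp: edge_representation_def partial_section_def dest: sets.sets_into_space)
    then have sx: "s a x \<in> space (carr (edg A))" and proj_sx: "proj (edg A) (s a x) = x"
      using x unfolding partial_section_def by (auto dest!: measurable_space simp: space_restrict_space)
    have ends: "org A (s a x) \<in> fibre (vtx A) x" "ter A (s a x) \<in> fibre (vtx A) x"
      using borel_graph_field_edge[OF AG sx] proj_sx by auto
    have xy: "(x, y) \<in> Map.graph (\<phi> a)" using y by (simp add: in_graphI)
    then have "(y, x) \<in> R"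
      using edge[OF a] symR by (auto simp: edge_representation_def full_pseudogroup_def)
    then have orb: "(act (vtx A) y x (ter A (s a x)), ter A (s a x)) \<in> orbit_rel R (vtx A)"
      and act: "proj (vtx A) (act (vtx A) y x (ter A (s a x))) = y"
      using orbit_rel_fibreI[OF fib(1) _ ends(2)] fib(1) ends(2)
      by (auto simp: rel_fibred_standard_space_def fibre_def)
    have "\<forall>x\<in>dom (\<phi> a). org A (s a x) \<in> vrep D \<rho> (tail (graph_of D) a) \<and>
        act (vtx A) (the (\<phi> a x)) x (ter A (s a x)) \<in> vrep D \<rho> (head (graph_of D) a)"
      using edge[OF a] unfolding edge_representation_def by (elim conjE)
    from bspec[OF this x] have reps: "org A (s a x) \<in> vrep D \<rho> (tail (graph_of D) a)"
      "act (vtx A) y x (ter A (s a x)) \<in> vrep D \<rho> (head (graph_of D) a)"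
      using y by simp_all
    have "rpt (org A (s a x)) x"
      using rpt_vrep[OF arc_ends(1)[OF aG] reps(1)] ends(1) unfolding fibre_def by simp
    moreover have "rpt (ter A (s a x)) y"
      using rpt_orbit[OF rpt_vrep[OF arc_ends(2)[OF aG] reps(2)] orb] act by simp
    moreover have "(x, y) \<in> F"
      using phiF[OF aG] a xy unfolding full_phi_def by (simp add: subset_iff)
    ultimately have "linked (org A (s a x)) (ter A (s a x))" unfolding linked_def by blast
    with sx show ?thesis ..
  qed
  \<comment> \<open>The edge saturations cover all edges and \<open>linked\<close> depends only on
    the orbits of the ends, so \<open>e\<close> may be replaced by an edge \<open>e'\<close> of some
    representation.\<close>
  have edge_linked: "linked (org A e) (ter A e)" if e: "e \<in> space (carr (edg A))" for e
  proof -
    obtain a e' where a: "a \<in> arcs (graph_of D)" and e': "e' \<in> full_erep A D Or T \<rho> \<phi> s a"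
      and orb: "(e', e) \<in> orbit_rel R (edg A)"
      using epart e unfolding saturations_partition_def by blast
    have "linked (org A e') (ter A e')"
    proof (cases "a \<in> arcs T")
      case True
      \<comment> \<open>Over the subtree both ends are representatives lying in one fibre, so they
        have the same base point as invariant.\<close>
      then have "e' \<in> erep D \<rho> a" using e' by (simp add: full_erep_def)
      then have reps: "org A e' \<in> vrep D \<rho> (tail (graph_of D) a)"
        "ter A e' \<in> vrep D \<rho> (head (graph_of D) a)"
        using erep_endpoints[OF DT rep, of a e'] True T by auto
      have "e' \<in> space (carr (edg A))" using orb by (simp add: orbit_rel_def)
      then have "proj (vtx A) (org A e') = proj (vtx A) (ter A e')"
        using borel_graph_field_edge[OF AG] by (simp add: fibre_def)
      moreover have "proj (vtx A) (ter A e') \<in> space X"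
        using reps(2) vrep_space[OF arc_ends(2)[OF a]] projV by blast
      ultimately show ?thesis
        using rpt_vrep[OF arc_ends(1)[OF a] reps(1)] rpt_vrep[OF arc_ends(2)[OF a] reps(2)] reflF
        unfolding linked_def by metis
    next
      case nT: False
      show ?thesis
      proof (cases "a \<in> Or")
        case True
        then show ?thesis using nT e' section_linked[of a] by (auto simp: full_erep_def)
      next
        \<comment> \<open>Here \<open>e'\<close> is the opposite of an edge of a section, so the
          ends are exchanged; \<open>linked\<close> is symmetric.\<close>
        case False
        then obtain x where x: "x \<in> dom (\<phi> (bar_of D a))" "e' = opp A (s (bar_of D a) x)"
          using nT e' by (auto simp: full_erep_def)
        show ?thesis
          using section_linked[OF orientation_bar[OF G sT Or a nT False] x(1)] linked_sym
            borel_graph_field_edge(3,4)[OF AG] x(2) by auto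
      qed
    qed
    then show ?thesis
      using morphism_orbit_rel[OF morph(1) orb] morphism_orbit_rel[OF morph(2) orb] rpt_orbit
      unfolding linked_def by blast
  qed
  have rpt_fibre: "(z, z') \<in> F"
    if x: "x \<in> space X" and v: "v \<in> fibre (vtx A) x" "v' \<in> fibre (vtx A) x"
      and z: "rpt v z" "rpt v' z'" for x v v' z z'
  proof -
    let ?G = "field_fibre A x"
    have tree: "serre_tree ?G (opp A)" using A x by (simp add: arboretum_def)
    then interpret Ax: wf_digraph ?G by (simp add: serre_tree_def serre_graph_iff)
    have "v \<rightarrow>\<^sup>*\<^bsub>?G\<^esub> v'"
      using tree v
      by (auto simp: serre_tree_def strongly_connected_def field_fibre_def subfield_fibre_def
          fibre_def)
    \<comment> \<open>With \<open>z\<close> fixed, quantifying over all invariants of the current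
      vertex lets the induction hypothesis apply to the one that \<open>linked\<close>
      supplies.\<close>
    then have "\<forall>z'. rpt v' z' \<longrightarrow> (z, z') \<in> F"
    proof (induction rule: Ax.reachable_induct)
      case base
      then show ?case using rpt_unique z(1) by blast
    next
      case (step y y')
      then obtain e where "e \<in> arcs ?G" "tail ?G e = y" "head ?G e = y'" by blast
      then have "linked y y'"
        using edge_linked[of e] by (auto simp: field_fibre_def subfield_fibre_def)
      then show ?case using step.IH rpt_unique transF unfolding linked_def by blast
    qed
    then show ?thesis using z(2) by blast
  qed
  show "R \<subseteq> F"
  proof (rule subrelI)
    fix x y assume xy: "(x, y) \<in> R"
    then have x: "x \<in> space X" and y: "y \<in> space X" using eqR by (auto simp: equiv_def)
    have P0: "P0 \<in> verts (graph_of D)"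
      using root T(2) by (simp add: rooted_tree_of_relations_def)
    obtain v where v: "v \<in> vrep D \<rho> P0" "proj (vtx A) v = x"
      using vrep_root_section[OF root rep x] by auto
    obtain w where w: "w \<in> vrep D \<rho> P0" "proj (vtx A) w = y"
      using vrep_root_section[OF root rep y] by auto
    have fibres: "v \<in> fibre (vtx A) x" "w \<in> fibre (vtx A) y"
      using v w vrep_space[OF P0] by (auto simp: fibre_def)
    \<comment> \<open>Translating \<open>w\<close> into the fibre over \<open>x\<close> keeps its
      orbit, hence its invariant \<open>y\<close>. The translate now lies in the same tree as
      \<open>v\<close>, which has invariant \<open>x\<close>.\<close>
    then have "act (vtx A) x y w \<in> fibre (vtx A) x"
      using fib(1) xy by (simp add: rel_fibred_standard_space_def)
    moreover have "rpt (act (vtx A) x y w) y"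
      using rpt_orbit[OF rpt_vrep[OF P0 w(1)]] symV[OF orbit_rel_fibreI[OF fib(1) xy fibres(2)]] w(2)
      by simp
    moreover have "rpt v x" using rpt_vrep[OF P0 v(1)] v(2) by simp
    ultimately show "(x, y) \<in> F" using rpt_fibre[OF x fibres(1)] by blast
  qed
qed

theorem proposition40:
  fixes X :: "'x measure" and R :: "('x \<times> 'x) set"
    and A :: "('x, 'v, 'e) graph_field"
    and D :: "('p, 'a, 'b, 'c) rel_graph"
    and Or :: "'a set" and T :: "('p, 'a) pre_digraph" and P0 :: 'p
    and \<rho> :: "('x, 'v, 'e, 'p, 'a, 'b, 'c) rep_map"
    and \<phi> :: "'a \<Rightarrow> 'x \<rightharpoonup> 'x"
  assumes "standard_borel X"
    and "borel_equiv_rel X R" and "countable_classes X R"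
    and "arboretum X R A"
    and "desingularization X R A D Or T P0 \<rho> \<phi>"
  shows "R = gen_equiv (space X)
               (vertex_generated X A D \<rho> \<union> edge_generated X A D Or T \<rho> \<phi>)"
proof
  show "R \<subseteq> gen_equiv (space X)
               (vertex_generated X A D \<rho> \<union> edge_generated X A D Or T \<rho> \<phi>)"
    using subset_generated[OF assms(2,4,5)] by (intro subset_gen_equivI) simp
  have "equiv (space X) R" and "borel_graph_field X R A"
    using assms(2,4) by (simp_all add: borel_equiv_rel_def arboretum_def)
  then show "gen_equiv (space X)
               (vertex_generated X A D \<rho> \<union> edge_generated X A D Or T \<rho> \<phi>) \<subseteq> R"
    using generators_subset[OF assms(2) _ assms(5)] by (intro gen_equiv_subset) simp_all
qed

end
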